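(* Let $\omega=1/16$, let $P^0$ satisfy the smallness hypotheses (H) stated in the context, let $P^{k+1}=S_{\mathrm H}(P^k)$ for $k\ge0$, and let $Z$ be the limit of the central coordinates $z^k$. Then the scaled second differences of the central data are uniformly bounded, and there is $K_0<\infty$ with $$\sup_i|z_{i+2}^k-2z_{i+1}^k+z_i^k|\le K_0\,2^{-k}\qquad(k\ge0).$$ Consequently $Z$ belongs to the Zygmund class $\Lambda_*$, and there is $K$ with $$\sup_x|Z(x+h)-2Z(x)+Z(x-h)|\le K|h|\qquad(h\in\mathbb{R}),$$ equivalently $Z$ has modulus of continuity $\omega_Z(h)=O(h\log(1/h))$. Moreover, the scaled first differences satisfy the uniform upper bound $$\sup_i\,2^k|z_{i+1}^k-z_i^k|=O(k)\qquad(k\to\infty).$$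
   Context: For a real sequence $u=\{u_i\}_{i\in\mathbb{Z}}$ the four-point operator $L_4$ with parameter $\omega$ is $(L_4u)_{2i}=u_i$, $(L_4u)_{2i+1}=-\omega u_{i-1}+(\tfrac12+\omega)u_i+(\tfrac12+\omega)u_{i+1}-\omega u_{i+2}$. The Heisenberg four-point subdivision operator $S_{\mathrm H}$ maps $P^k=\{(x_i^k,y_i^k,z_i^k)\}_{i\in\mathbb{Z}}\subset\mathbb{R}^3$ to $P^{k+1}$ defined by $P^{k+1}_{2i}=P^k_i$ and $P^{k+1}_{2i+1}=(X_{2i+1},Y_{2i+1},Z_{2i+1})$ with $X_{2i+1}=(L_4x^k)_{2i+1}$, $Y_{2i+1}=(L_4y^k)_{2i+1}$, $Z_{2i+1}=(L_4z^k)_{2i+1}+R_i^k$, where $R_i^k=\tfrac12(x_i^kb_i^k-y_i^ka_i^k)$, $a_i^k=X_{2i+1}-x_i^k$, $b_i^k=Y_{2i+1}-y_i^k$. The sequence $z^k=\{z_i^k\}_{i\in\mathbb{Z}}$ is called the central data at level $k$. Notation: $\|\Delta_hP\|_\infty=\sup_i(|x_{i+1}-x_i|+|y_{i+1}-y_i|)$ and $\|\Delta_h^2P\|_\infty=\sup_i(|x_{i+1}-2x_i+x_{i-1}|+|y_{i+1}-2y_i+y_{i-1}|)$. Hypotheses (H): $\sup_i\|P_i^0\|\le C$, $\|\Delta_hP^0\|_\infty\le\varepsilon_0$, $\|\Delta_h^2P^0\|_\infty\le\varepsilon_0$, for a fixed constant $C$ and a sufficiently small $\varepsilon_0>0$ depending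 only on $\omega=1/16$. $Z:\mathbb{R}\to\mathbb{R}$ is the continuous function which is the uniform-on-compact-intervals limit of the piecewise-linear interpolants taking the values $z_i^k$ at the dyadic nodes $i2^{-k}$. The Zygmund class $\Lambda_*$ consists of the continuous functions $g$ on $\mathbb{R}$ for which there is a finite constant $K$ with $\sup_x|g(x+h)-2g(x)+g(x-h)|\le K|h|$ for all $h\in\mathbb{R}$. The modulus of continuity is $\omega_Z(h)=\sup_{|s-t|\le h}|Z(s)-Z(t)|$, and the bound $O(h\log(1/h))$ is understood as $h\to0^+$. *)

theory Defs
  imports "HOL-Analysis.Analysis" "HOL-Library.Landau_Symbols"
begin

text \<open>
  Suprema are taken in the extended reals, so that a supremum over an unbounded family is
  \<open>\<infinity>\<close> and not an unspecified real number.  Points of three-space are nested pairs, whose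
  library norm is the Euclidean one.
\<close>

type_synonym point = "real \<times> real \<times> real"

definition xco :: "point \<Rightarrow> real" where "xco p = fst p"
definition yco :: "point \<Rightarrow> real" where "yco p = fst (snd p)"
definition zco :: "point \<Rightarrow> real" where "zco p = snd (snd p)"

text \<open>Since \<open>div\<close> on \<^typ>\<open>int\<close> rounds down, \<open>(2 * i + 1) div 2 = i\<close> also for negative \<open>i\<close>.\<close>

definition L4 :: "real \<Rightarrow> (int \<Rightarrow> real) \<Rightarrow> int \<Rightarrow> real" where
  "L4 w u j =
    (let i = j div 2 in
     if even j then u i
     else - w * u (i - 1) + (1/2 + w) * u i + (1/2 + w) * u (i + 1) - w * u (i + 2))"

definition heis_subdiv :: "real \<Rightarrow> (int \<Rightarrow> point) \<Rightarrow> int \<Rightarrow> point" where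
  "heis_subdiv w P j =
    (let i = j div 2;
         X = L4 w (\<lambda>n. xco (P n)) j;
         Y = L4 w (\<lambda>n. yco (P n)) j;
         a = X - xco (P i);
         b = Y - yco (P i);
         R = 1/2 * (xco (P i) * b - yco (P i) * a)
     in if even j then P i
        else (X, Y, L4 w (\<lambda>n. zco (P n)) j + R))"

definition hdiff_norm :: "(int \<Rightarrow> point) \<Rightarrow> ereal" where
  "hdiff_norm P =
    (SUP i. ereal (\<bar>xco (P (i + 1)) - xco (P i)\<bar> + \<bar>yco (P (i + 1)) - yco (P i)\<bar>))"

definition hdiff2_norm :: "(int \<Rightarrow> point) \<Rightarrow> ereal" where
  "hdiff2_norm P =
    (SUP i. ereal (\<bar>xco (P (i + 1)) - 2 * xco (P i) + xco (P (i - 1))\<bar>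
                 + \<bar>yco (P (i + 1)) - 2 * yco (P i) + yco (P (i - 1))\<bar>))"

definition small_data :: "real \<Rightarrow> real \<Rightarrow> (int \<Rightarrow> point) \<Rightarrow> bool" where
  "small_data C \<epsilon> P \<longleftrightarrow>
    (SUP i. ereal (norm (P i))) \<le> ereal C \<and> hdiff_norm P \<le> ereal \<epsilon> \<and> hdiff2_norm P \<le> ereal \<epsilon>"

text \<open>Piecewise-linear interpolant of the values \<open>u i\<close> at the nodes \<open>i / 2 ^ k\<close>.\<close>

definition pl_interp :: "nat \<Rightarrow> (int \<Rightarrow> real) \<Rightarrow> real \<Rightarrow> real" where
  "pl_interp k u t =
    (let i = \<lfloor>2 ^ k * t\<rfloor>; s = 2 ^ k * t - of_int i in (1 - s) * u i + s * u (i + 1))"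

definition is_central_limit :: "(nat \<Rightarrow> int \<Rightarrow> point) \<Rightarrow> (real \<Rightarrow> real) \<Rightarrow> bool" where
  "is_central_limit P Z \<longleftrightarrow>
    continuous_on UNIV Z \<and>
    (\<forall>a b. uniform_limit {a..b} (\<lambda>k. pl_interp k (\<lambda>i. zco (P k i))) Z sequentially)"

definition second_diff_sup :: "(real \<Rightarrow> real) \<Rightarrow> real \<Rightarrow> ereal" where
  "second_diff_sup g h = (SUP x. ereal \<bar>g (x + h) - 2 * g x + g (x - h)\<bar>)"

definition zygmund_class :: "(real \<Rightarrow> real) set" where
  "zygmund_class =
    {g. continuous_on UNIV g \<and> (\<exists>K. \<forall>h. second_diff_sup g h \<le> ereal (K * \<bar>h\<bar>))}"

definition modulus_of_continuity :: "(real \<Rightarrow> real) \<Rightarrow> real \<Rightarrow> ereal" where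
  "modulus_of_continuity g h = (SUP (s, t)\<in>{(s, t). \<bar>s - t\<bar> \<le> h}. ereal \<bar>g s - g t\<bar>)"

end

theory Submission
  imports Defs
begin

text \<open>
  Each coordinate of the Heisenberg scheme follows the linear four-point scheme with a forcing
  term \<open>R\<close> at the inserted points.  For the horizontal coordinates \<open>R = 0\<close>; for the central
  coordinate \<open>R\<close> is the symplectic area term.  The second differences of a coordinate obey a
  refinement rule of their own, with mask \<open>(-1, 2, 6, 2, -1) / 16\<close>, forced by \<open>R\<close>.  The norm of
  one step of this rule is \<open>1/2\<close>.  A forcing of size \<open>2\<^sup>-\<^sup>k\<close> is in resonance with this rate, so that
  one step alone would only give second differences of size \<open>k 2\<^sup>-\<^sup>k\<close>.  Two steps together have
  norm \<open>3/16\<close>, strictly less than \<open>1/4\<close> (\<open>second_diff_two_step\<close>), and this gap is the heart of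
  the proof: the second differences inherit the rate of decay \<open>\<mu>\<close> of the forcing even for some
  \<open>\<mu> < 1/2\<close>, and without loss at \<open>\<mu> = 1/2\<close> (\<open>second_diff_decay\<close>).

  The gap is used twice.  Without forcing, the horizontal second differences decay like
  \<open>(9/20)\<^sup>k\<close>, faster than \<open>2\<^sup>-\<^sup>k\<close>; hence their scaled sum converges, the horizontal coordinates
  stay bounded and their first differences are \<open>O(2\<^sup>-\<^sup>k)\<close>.  The area term is bilinear in a point
  and a first difference, so it is \<open>O(2\<^sup>-\<^sup>k)\<close> as well.  The gap, now at the rate \<open>\<mu> = 1/2\<close>,
  bounds the central second differences by a multiple of \<open>2\<^sup>-\<^sup>k\<close>.  First differences are halved
  in each step up to an error of this critical size, so they can accumulate a factor \<open>k\<close>, but not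
  more (\<open>first_diff_decay_critical\<close>).

  The inserted values differ from the midpoints of their neighbours by \<open>O(2\<^sup>-\<^sup>k)\<close>, hence the
  interpolants converge uniformly on the line with error \<open>O(2\<^sup>-\<^sup>k)\<close>.  At a step \<open>h\<close> comparable to
  \<open>2\<^sup>-\<^sup>k\<close> the limit may therefore be replaced by the interpolant of level \<open>k\<close>, whose second
  differences are controlled by those of the data (\<open>limit_zygmund\<close>) and whose oscillation is
  controlled by the first differences, where \<open>k\<close> turns into \<open>log (1/h)\<close> (\<open>limit_log_modulus\<close>).
\<close>

section \<open>The forced four-point scheme\<close>

definition second_diff :: "(int \<Rightarrow> real) \<Rightarrow> int \<Rightarrow> real" where
  "second_diff u i = u (i + 1) - 2 * u i + u (i - 1)"

text \<open>
  The value at an inserted point is written as the midpoint of its neighbours minus \<open>1/16\<close> times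
  two second differences.  All later estimates read off the smoothness from this form.
\<close>

locale perturbed_four_point =
  fixes u R :: "nat \<Rightarrow> int \<Rightarrow> real"
  assumes even_rule: "u (Suc k) (2 * i) = u k i"
    and odd_rule: "u (Suc k) (2 * i + 1) =
      (u k i + u k (i + 1)) / 2 - (second_diff (u k) i + second_diff (u k) (i + 1)) / 16 + R k i"
begin

lemma second_diff_even:
  "second_diff (u (Suc k)) (2 * i) =
    3/8 * second_diff (u k) i - (second_diff (u k) (i - 1) + second_diff (u k) (i + 1)) / 16
    + R k (i - 1) + R k i"
proof -
  have "u (Suc k) (2 * i - 1) =
      (u k (i - 1) + u k i) / 2 - (second_diff (u k) (i - 1) + second_diff (u k) i) / 16 + R k (i - 1)"
    using odd_rule[of k "i - 1"] by (simp add: algebra_simps)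
  then show ?thesis
    using odd_rule[of k i] even_rule[of k i]
    unfolding second_diff_def[of "u (Suc k)"] by (simp add: second_diff_def field_simps)
qed

lemma second_diff_odd:
  "second_diff (u (Suc k)) (2 * i + 1) =
    (second_diff (u k) i + second_diff (u k) (i + 1)) / 8 - 2 * R k i"
proof -
  have "u (Suc k) (2 * i + 1 + 1) = u k (i + 1)"
    using even_rule[of k "i + 1"] by (simp add: algebra_simps)
  then show ?thesis
    using odd_rule[of k i] even_rule[of k i]
    unfolding second_diff_def[of "u (Suc k)"] by (simp add: second_diff_def field_simps)
qed

text \<open>
  The coefficients \<open>3/8, 1/16, 1/16\<close> at old points have absolute sum \<open>1/2\<close>.  This bound only
  starts the two-step induction at level one.
\<close>

lemma second_diff_one_step:
  assumes E: "\<And>i. \<bar>second_diff (u k) i\<bar> \<le> E" and r: "\<And>i. \<bar>R k i\<bar> \<le> r"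
  shows "\<bar>second_diff (u (Suc k)) j\<bar> \<le> E / 2 + 2 * r"
proof -
  define i where "i = j div 2"
  have "j = 2 * i \<or> j = 2 * i + 1" unfolding i_def by presburger
  then show ?thesis
  proof
    assume "j = 2 * i"
    then show ?thesis
      using second_diff_even[of k i] E[of i, THEN abs_le_D1] E[of i, THEN abs_le_D2]
        E[of "i - 1", THEN abs_le_D1] E[of "i - 1", THEN abs_le_D2]
        E[of "i + 1", THEN abs_le_D1] E[of "i + 1", THEN abs_le_D2]
        r[of i, THEN abs_le_D1] r[of i, THEN abs_le_D2]
        r[of "i - 1", THEN abs_le_D1] r[of "i - 1", THEN abs_le_D2]
      by (intro abs_leI; (simp; argo?))
  next
    assume "j = 2 * i + 1"
    then show ?thesis
      using second_diff_odd[of k i] E[of i] E[of "i + 1"] r[of i] by (simp add: abs_le_iff) argo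
  qed
qed

text \<open>
  The mask of two steps, in units of \<open>1/256\<close>, is symmetric with the values
  \<open>32, 16, 7, 2, -8, -2, 1\<close> at \<open>0, ..., 6\<close>.  Its four residue classes modulo 4 have absolute sums
  48, 20, 16 and 20, and the largest, \<open>48/256 = 3/16\<close>, is the norm.  The terms of opposite sign cancel
  only when both steps are expanded, which the square of the one-step bound cannot see.
\<close>

lemma second_diff_two_step:
  assumes E: "\<And>i. \<bar>second_diff (u k) i\<bar> \<le> E"
    and r: "\<And>i. \<bar>R k i\<bar> \<le> r" and r': "\<And>i. \<bar>R (Suc k) i\<bar> \<le> r'"
  shows "\<bar>second_diff (u (Suc (Suc k))) j\<bar> \<le> 3/16 * E + r + 2 * r'"
proof -
  \<comment> \<open>Each residue of \<open>j\<close> modulo 4 selects its own coefficients of the two-step mask.\<close>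
  define i where "i = j div 4"
  have e: "second_diff (u (Suc k)) (2 * i - 1) =
      (second_diff (u k) (i - 1) + second_diff (u k) i) / 8 - 2 * R k (i - 1)"
    using second_diff_odd[of k "i - 1"] by simp
  have e2: "second_diff (u (Suc k)) (2 + 2 * i) =
    3/8 * second_diff (u k) (i + 1) - (second_diff (u k) i + second_diff (u k) (i + 2)) / 16
    + R k i + R k (i + 1)"
    using second_diff_even[of k "i + 1"] by (simp add: algebra_simps)
  note e0 = second_diff_even[of k i] and e1 = second_diff_odd[of k i]
  have b: "\<bar>second_diff (u k) (i - 1)\<bar> \<le> E" "\<bar>second_diff (u k) i\<bar> \<le> E"
    "\<bar>second_diff (u k) (i + 1)\<bar> \<le> E" "\<bar>second_diff (u k) (i + 2)\<bar> \<le> E"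
    "\<bar>R k (i - 1)\<bar> \<le> r" "\<bar>R k i\<bar> \<le> r" "\<bar>R k (i + 1)\<bar> \<le> r"
    "\<bar>R (Suc k) (2 * i - 1)\<bar> \<le> r'" "\<bar>R (Suc k) (2 * i)\<bar> \<le> r'" "\<bar>R (Suc k) (2 * i + 1)\<bar> \<le> r'"
    by (auto intro: E r r')
  note b' = b[THEN abs_le_D1] b[THEN abs_le_D2]
  have "j = 4 * i \<or> j = 4 * i + 1 \<or> j = 4 * i + 2 \<or> j = 3 + 4 * i"
    unfolding i_def by presburger
  then consider "j = 4 * i" | "j = 4 * i + 1" | "j = 4 * i + 2" | "j = 3 + 4 * i" by blast
  then show ?thesis
  proof cases
    case 1
    then show ?thesis
      using second_diff_even[of "Suc k" "2 * i"] b'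
      unfolding e e0 e1 by (intro abs_leI; (simp; argo?))
  next
    case 2
    then show ?thesis
      using second_diff_odd[of "Suc k" "2 * i"] b'
      unfolding e0 e1 by (intro abs_leI; (simp; argo?))
  next
    case 3
    then show ?thesis
      using second_diff_even[of "Suc k" "2 * i + 1"] b'
      by (intro abs_leI; (simp add: e0 e1 e2; argo?))
  next
    case 4
    then show ?thesis
      using second_diff_odd[of "Suc k" "2 * i + 1"] b'
      by (intro abs_leI; (simp add: e1 e2; argo?))
  qed
qed

text \<open>
  An induction over pairs of consecutive levels.  It closes as soon as
  \<open>3/16 K + \<rho> + 2 \<rho> \<mu> \<le> K \<mu>\<^sup>2\<close>, which holds for large \<open>K\<close> because \<open>\<mu>\<^sup>2 > 3/16\<close>.  The threshold
  \<open>9/20\<close> is a rational number between \<open>sqrt 3 / 4\<close> and the critical rate \<open>1/2\<close>.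
\<close>

lemma second_diff_decay:
  assumes B: "\<And>i. \<bar>second_diff (u 0) i\<bar> \<le> B"
    and R: "\<And>k i. \<bar>R k i\<bar> \<le> \<rho> * \<mu> ^ k" and \<mu>: "9/20 \<le> \<mu>" "\<mu> \<le> 1"
  shows "\<exists>K. \<forall>k i. \<bar>second_diff (u k) i\<bar> \<le> K * \<mu> ^ k"
proof -
  have \<rho>: "0 \<le> \<rho>" using R[of 0 0] by simp
  have B0: "0 \<le> B" using B[of 0] by linarith
  \<comment> \<open>As \<open>(9/20)\<^sup>2 - 3/16 = 3/200\<close>, absorbing \<open>3 \<rho>\<close> in the induction step costs \<open>K \<ge> 200 \<rho>\<close>.
    Level one needs \<open>B / 2 + 2 \<rho> \<le> 9/20 K\<close>.\<close>
  define K where "K = 2 * B + 300 * \<rho>"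
  have "0 \<le> K" using \<rho> B0 by (simp add: K_def)
  have sq: "81/400 \<le> \<mu> ^ 2" using power_mono[OF \<mu>(1), of 2] by (simp add: power2_eq_square)
  have step: "(\<forall>i. \<bar>second_diff (u k) i\<bar> \<le> K * \<mu> ^ k) \<and>
      (\<forall>i. \<bar>second_diff (u (Suc k)) i\<bar> \<le> K * \<mu> ^ Suc k)" for k
  proof (induction k)
    case 0
    have "\<bar>second_diff (u (Suc 0)) i\<bar> \<le> K * \<mu>" for i
    proof -
      have "\<bar>second_diff (u (Suc 0)) i\<bar> \<le> B / 2 + 2 * \<rho>"
        by (rule second_diff_one_step[OF B]) (use R[of 0] in simp)
      also have "\<dots> \<le> K * (9/20)" using B0 \<rho> by (simp add: K_def)
      also have "\<dots> \<le> K * \<mu>" using \<mu> \<open>0 \<le> K\<close> by (intro mult_left_mono) auto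
      finally show ?thesis .
    qed
    moreover have "\<bar>second_diff (u 0) i\<bar> \<le> K" for i
      using B[of i] B0 \<rho> by (simp add: K_def)
    ultimately show ?case by simp
  next
    case (Suc k)
    have "\<bar>second_diff (u (Suc (Suc k))) i\<bar> \<le> K * \<mu> ^ Suc (Suc k)" for i
    proof -
      have "\<bar>second_diff (u (Suc (Suc k))) i\<bar>
          \<le> 3/16 * (K * \<mu> ^ k) + \<rho> * \<mu> ^ k + 2 * (\<rho> * \<mu> ^ Suc k)"
        using Suc by (intro second_diff_two_step R) auto
      also have "\<dots> = (3/16 * K + \<rho> + 2 * \<rho> * \<mu>) * \<mu> ^ k" by (simp add: algebra_simps)
      also have "\<dots> \<le> (K * \<mu> ^ 2) * \<mu> ^ k"
      proof (rule mult_right_mono)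
        have "2 * \<rho> * \<mu> \<le> 2 * \<rho> * 1" using \<mu> \<rho> by (intro mult_left_mono) auto
        moreover have "K * (81/400) \<le> K * \<mu> ^ 2" using sq \<open>0 \<le> K\<close> by (intro mult_left_mono)
        moreover have "3/16 * K + 3 * \<rho> \<le> K * (81/400)" using B0 \<rho> by (simp add: K_def)
        ultimately show "3/16 * K + \<rho> + 2 * \<rho> * \<mu> \<le> K * \<mu> ^ 2" by linarith
      qed (use \<mu> in simp)
      finally show ?thesis by (simp add: power2_eq_square mult_ac)
    qed
    with Suc show ?case by blast
  qed
  then show ?thesis by blast
qed

lemma midpoint_deviation:
  assumes "\<And>i. \<bar>second_diff (u k) i\<bar> \<le> K * q" and "\<And>i. \<bar>R k i\<bar> \<le> \<rho> * q"
  shows "\<bar>u (Suc k) (2 * i + 1) - (u k i + u k (i + 1)) / 2\<bar> \<le> (K / 8 + \<rho>) * q"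
  using odd_rule[of k i] assms(1)[of i] assms(1)[of "i + 1"] assms(2)[of i]
  by (simp add: distrib_right add_divide_distrib; linarith)

lemma first_diff_step:
  assumes D: "\<And>i. \<bar>u k (i + 1) - u k i\<bar> \<le> D"
    and m: "\<And>i. \<bar>u (Suc k) (2 * i + 1) - (u k i + u k (i + 1)) / 2\<bar> \<le> m"
  shows "\<bar>u (Suc k) (j + 1) - u (Suc k) j\<bar> \<le> D / 2 + m"
proof -
  define i where "i = j div 2"
  have "j = 2 * i \<or> j = 2 * i + 1" unfolding i_def by presburger
  then show ?thesis
  proof
    assume "j = 2 * i"
    then show ?thesis using even_rule[of k i] D[of i] m[of i] by (simp add: abs_le_iff) argo
  next
    assume j: "j = 2 * i + 1"
    have "u (Suc k) (j + 1) = u k (i + 1)"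
      using even_rule[of k "i + 1"] by (simp add: j algebra_simps)
    then show ?thesis using D[of i] m[of i] by (simp add: j abs_le_iff) argo
  qed
qed

text \<open>
  When the midpoint deviation decays faster than \<open>2\<^sup>-\<^sup>k\<close>, halving wins and no factor \<open>k\<close> appears.
\<close>

lemma first_diff_decay_fast:
  assumes D: "\<And>i. \<bar>u 0 (i + 1) - u 0 i\<bar> \<le> D"
    and m: "\<And>k i. \<bar>u (Suc k) (2 * i + 1) - (u k i + u k (i + 1)) / 2\<bar> \<le> m * (9/20) ^ k"
  shows "\<bar>u k (j + 1) - u k j\<bar> \<le> (D + 20 * m) * (1/2) ^ k"
proof -
  \<comment> \<open>The subtracted term makes the bound inductive; \<open>20\<close> is the inverse of \<open>1/2 - 9/20\<close>.\<close>
  have "\<bar>u k (j + 1) - u k j\<bar> \<le> (D + 20 * m) * (1/2) ^ k - 20 * m * (9/20) ^ k"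
  proof (induction k arbitrary: j)
    case 0 show ?case using D by simp
  next
    case (Suc k)
    from first_diff_step[OF Suc m, of j] show ?case by (simp add: field_simps)
  qed
  moreover have "0 \<le> 20 * m * (9/20) ^ k" using m[of 0 0] by simp
  ultimately show ?thesis by linarith
qed

text \<open>
  At the critical rate every level adds the same amount \<open>2 m\<close> to the scaled first difference.
\<close>

lemma first_diff_decay_critical:
  assumes D: "\<And>i. \<bar>u 0 (i + 1) - u 0 i\<bar> \<le> D"
    and m: "\<And>k i. \<bar>u (Suc k) (2 * i + 1) - (u k i + u k (i + 1)) / 2\<bar> \<le> m * (1/2) ^ k"
  shows "\<bar>u k (j + 1) - u k j\<bar> \<le> (D + 2 * m * real k) * (1/2) ^ k"
proof (induction k arbitrary: j)
  case 0 show ?case using D by simp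
next
  case (Suc k)
  from first_diff_step[OF Suc m, of j] show ?case by (simp add: field_simps)
qed

lemma values_bounded:
  assumes C: "\<And>i. \<bar>u 0 i\<bar> \<le> C"
    and m: "\<And>k i. \<bar>u (Suc k) (2 * i + 1) - (u k i + u k (i + 1)) / 2\<bar> \<le> m * (9/20) ^ k"
  shows "\<bar>u k j\<bar> \<le> C + 2 * m"
proof -
  have m0: "0 \<le> m" using m[of 0 0] by simp
  \<comment> \<open>The subtracted term pays for the increments of all later levels.\<close>
  have "\<bar>u k j\<bar> \<le> C + 2 * m - 2 * m * (9/20) ^ k"
  proof (induction k arbitrary: j)
    case 0 show ?case using C by simp
  next
    case (Suc k)
    define i where "i = j div 2"
    have p: "0 \<le> m * (9/20) ^ k" using m0 by simp
    have "j = 2 * i \<or> j = 2 * i + 1" unfolding i_def by presburger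
    then show ?case
    proof
      assume "j = 2 * i"
      then show ?thesis using even_rule[of k i] Suc[of i] p by simp
    next
      assume "j = 2 * i + 1"
      then show ?thesis using m[of k i] Suc[of i] Suc[of "i + 1"] p by (simp add: abs_le_iff) argo
    qed
  qed
  moreover have "0 \<le> 2 * m * (9/20) ^ k" using m0 by simp
  ultimately show ?thesis by linarith
qed

end

section \<open>Piecewise linear interpolants\<close>

text \<open>
  The two interpolants agree at the old nodes, and on each old interval they differ by the midpoint
  deviation times a hat function.
\<close>

lemma pl_interp_refine:
  assumes even: "\<And>i. v (2 * i) = u i"
    and odd: "\<And>i. \<bar>v (2 * i + 1) - (u i + u (i + 1)) / 2\<bar> \<le> \<delta>"
  shows "\<bar>pl_interp (Suc k) v t - pl_interp k u t\<bar> \<le> \<delta>"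
proof -
  define i where "i = \<lfloor>2 ^ k * t\<rfloor>"
  define s where "s = 2 ^ k * t - of_int i"
  have s: "0 \<le> s" "s < 1" unfolding s_def i_def by linarith+
  have t: "2 ^ Suc k * t = 2 * of_int i + 2 * s" by (simp add: s_def)
  have u: "pl_interp k u t = (1 - s) * u i + s * u (i + 1)"
    by (simp add: pl_interp_def Let_def i_def s_def)
  define m where "m = v (2 * i + 1) - (u i + u (i + 1)) / 2"
  have m: "\<bar>m\<bar> \<le> \<delta>" unfolding m_def by (rule odd)
  have v1: "v (2 * i + 1) = m + (u i + u (i + 1)) / 2" by (simp add: m_def)
  have v2: "v (2 + 2 * i) = u (i + 1)" using even[of "i + 1"] by (simp add: algebra_simps)
  obtain c where c: "pl_interp (Suc k) v t - pl_interp k u t = c * m" "\<bar>c\<bar> \<le> 1"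
  proof (cases "s < 1/2")
    case True
    have f: "\<lfloor>2 ^ Suc k * t\<rfloor> = 2 * i" unfolding t using s True by (intro floor_unique) auto
    have "pl_interp (Suc k) v t = (1 - 2 * s) * u i + 2 * s * (m + (u i + u (i + 1)) / 2)"
      unfolding pl_interp_def Let_def f unfolding t by (simp add: v1 even)
    with u have "pl_interp (Suc k) v t - pl_interp k u t = (2 * s) * m"
      by (simp add: field_simps)
    then show ?thesis using that[of "2 * s"] s True by simp
  next
    case False
    have f: "\<lfloor>2 ^ Suc k * t\<rfloor> = 2 * i + 1" unfolding t using s False by (intro floor_unique) auto
    have "pl_interp (Suc k) v t
        = (2 - 2 * s) * (m + (u i + u (i + 1)) / 2) + (2 * s - 1) * u (i + 1)"
      unfolding pl_interp_def Let_def f unfolding t by (simp add: v1 v2)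
    with u have "pl_interp (Suc k) v t - pl_interp k u t = (2 - 2 * s) * m"
      by (simp add: field_simps)
    then show ?thesis using that[of "2 - 2 * s"] s False by simp
  qed
  have "\<bar>c * m\<bar> \<le> 1 * \<bar>m\<bar>" unfolding abs_mult using c(2) by (intro mult_right_mono) auto
  with c(1) m show ?thesis by simp
qed

text \<open>
  Two points at most one mesh width apart lie in equal or adjacent cells, so the path from one to
  the other through the left endpoints of their cells costs at most three differences.
\<close>

lemma pl_interp_near:
  assumes D: "\<And>i. \<bar>u (i + 1) - u i\<bar> \<le> D" and st: "2 ^ k * \<bar>s - t\<bar> \<le> 1"
  shows "\<bar>pl_interp k u s - pl_interp k u t\<bar> \<le> 3 * D"
proof -
  have node: "\<bar>pl_interp k u x - u \<lfloor>2 ^ k * x\<rfloor>\<bar> \<le> D" for x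
  proof -
    define i where "i = \<lfloor>2 ^ k * x\<rfloor>"
    define r where "r = 2 ^ k * x - of_int i"
    have r: "0 \<le> r" "r < 1" unfolding r_def i_def by linarith+
    have "pl_interp k u x - u i = r * (u (i + 1) - u i)"
      by (simp add: pl_interp_def Let_def i_def r_def algebra_simps)
    also have "\<bar>\<dots>\<bar> \<le> 1 * \<bar>u (i + 1) - u i\<bar>"
      unfolding abs_mult using r by (intro mult_right_mono) auto
    finally show ?thesis using D[of i] by (simp add: i_def)
  qed
  have "\<bar>2 ^ k * s - 2 ^ k * t\<bar> \<le> 1"
    using st by (simp add: abs_mult flip: right_diff_distrib)
  then have "\<lfloor>2 ^ k * s\<rfloor> = \<lfloor>2 ^ k * t\<rfloor> \<or> \<lfloor>2 ^ k * s\<rfloor> = \<lfloor>2 ^ k * t\<rfloor> + 1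
      \<or> \<lfloor>2 ^ k * t\<rfloor> = \<lfloor>2 ^ k * s\<rfloor> + 1"
    by linarith
  then have "\<bar>u \<lfloor>2 ^ k * s\<rfloor> - u \<lfloor>2 ^ k * t\<rfloor>\<bar> \<le> D"
    using D[of "\<lfloor>2 ^ k * t\<rfloor>"] D[of "\<lfloor>2 ^ k * s\<rfloor>"] by (auto simp: abs_minus_commute)
  with node[of s] node[of t] show ?thesis by linarith
qed

text \<open>
  Within one mesh width of \<open>x\<close> the interpolant deviates from the affine function that extends
  its piece at \<open>x\<close> by at most one second difference of the data, since only one slope change can be
  passed.  An affine function has second difference zero.
\<close>

lemma pl_interp_second_diff:
  assumes E: "\<And>i. \<bar>second_diff u i\<bar> \<le> E" and h: "2 ^ k * \<bar>h\<bar> \<le> 1"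
  shows "\<bar>pl_interp k u (x + h) - 2 * pl_interp k u x + pl_interp k u (x - h)\<bar> \<le> 2 * E"
proof -
  define n where "n = \<lfloor>2 ^ k * x\<rfloor>"
  define l where "l t = u n + (2 ^ k * t - of_int n) * (u (n + 1) - u n)" for t
  have near: "\<bar>pl_interp k u t - l t\<bar> \<le> E" if t: "\<bar>2 ^ k * t - 2 ^ k * x\<bar> \<le> 1" for t
  proof -
    define i where "i = \<lfloor>2 ^ k * t\<rfloor>"
    define s where "s = 2 ^ k * t - of_int i"
    have s: "0 \<le> s" "s < 1" unfolding s_def i_def by linarith+
    have tt: "2 ^ k * t = of_int i + s" by (simp add: s_def)
    have p: "pl_interp k u t = (1 - s) * u i + s * u (i + 1)"
      by (simp add: pl_interp_def Let_def i_def s_def)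
    have "i = n - 1 \<or> i = n \<or> i = n + 1" using t unfolding i_def n_def by linarith
    then obtain c j where "pl_interp k u t - l t = c * second_diff u j" "\<bar>c\<bar> \<le> 1"
    proof (elim disjE)
      assume i: "i = n - 1"
      have "pl_interp k u t - l t = (1 - s) * second_diff u n"
        unfolding p l_def tt second_diff_def i by (simp add: algebra_simps)
      then show ?thesis using that[of "1 - s" n] s by simp
    next
      assume i: "i = n"
      have "pl_interp k u t - l t = 0 * second_diff u n"
        unfolding p l_def tt second_diff_def i by (simp add: algebra_simps)
      then show ?thesis using that[of 0 n] by simp
    next
      assume i: "i = n + 1"
      have "pl_interp k u t - l t = s * second_diff u (n + 1)"
        unfolding p l_def tt second_diff_def i by (simp add: algebra_simps)
      then show ?thesis using that[of s "n + 1"] s by simp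
    qed
    moreover have "\<bar>c * second_diff u j\<bar> \<le> 1 * E"
      unfolding abs_mult using \<open>\<bar>c\<bar> \<le> 1\<close> E by (intro mult_mono) auto
    ultimately show ?thesis by simp
  qed
  have a: "\<bar>2 ^ k * h\<bar> \<le> 1" using h by (simp add: abs_mult)
  have x: "pl_interp k u x = l x"
    by (simp add: pl_interp_def Let_def l_def n_def algebra_simps)
  have "\<bar>pl_interp k u (x + h) - l (x + h)\<bar> \<le> E" "\<bar>pl_interp k u (x - h) - l (x - h)\<bar> \<le> E"
    using a by (intro near; simp add: algebra_simps)+
  moreover have "l (x + h) - 2 * l x + l (x - h) = 0" by (simp add: l_def algebra_simps)
  ultimately show ?thesis using x by linarith
qed

section \<open>Passing to the limit\<close>

lemma geometric_increments_limit:
  fixes f :: "nat \<Rightarrow> real"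
  assumes inc: "\<And>k. \<bar>f (Suc k) - f k\<bar> \<le> m * (1/2) ^ k"
  obtains l where "f \<longlonglongrightarrow> l" "\<And>k. \<bar>f k - l\<bar> \<le> 2 * m * (1/2) ^ k"
proof -
  have major: "summable (\<lambda>k. m * (1/2::real) ^ k)"
    by (intro summable_mult summable_geometric) auto
  have "summable (\<lambda>k. f (Suc k) - f k)"
    by (rule summable_comparison_test'[OF major, of 0]) (use inc in simp)
  then have "convergent (\<lambda>n. f n - f 0)"
    by (simp add: summable_iff_convergent sum_lessThan_telescope)
  then have "convergent f" by (simp add: convergent_diff_const_right_iff)
  then obtain l where l: "f \<longlonglongrightarrow> l" by (auto simp: convergent_def)
  have "\<bar>f k - l\<bar> \<le> 2 * m * (1/2) ^ k" for k
  proof -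
    have m: "0 \<le> m" using inc[of 0] by simp
    have b: "\<bar>f k - f (n + k)\<bar> \<le> 2 * m * (1/2) ^ k - 2 * m * (1/2) ^ (n + k)" for n
    proof (induction n)
      case (Suc n)
      then show ?case using inc[of "n + k"] by simp
    qed simp
    have "\<bar>f k - f (n + k)\<bar> \<le> 2 * m * (1/2) ^ k" for n
    proof -
      have "0 \<le> 2 * m * (1/2) ^ (n + k)" using m by simp
      with b[of n] show ?thesis by linarith
    qed
    moreover have "(\<lambda>n. \<bar>f k - f (n + k)\<bar>) \<longlonglongrightarrow> \<bar>f k - l\<bar>"
      by (intro tendsto_intros LIMSEQ_ignore_initial_segment l)
    ultimately show ?thesis by (intro LIMSEQ_le_const2) auto
  qed
  with l that show ?thesis by blast
qed

lemma dyadic_scale: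
  fixes h :: real
  assumes "0 < h" "h \<le> 1"
  obtains k :: nat where "(1/2) ^ Suc k < h" "h \<le> (1/2) ^ k"
proof -
  define k where "k = (LEAST k. (1/2::real) ^ Suc k < h)"
  obtain n where n: "(1/2::real) ^ n < h" using real_arch_pow_inv[OF assms(1), of "1/2"] by auto
  then have "(1/2::real) ^ Suc n < h" using assms by (simp add: field_simps)
  then have a: "(1/2::real) ^ Suc k < h" unfolding k_def by (rule LeastI)
  have "h \<le> (1/2) ^ k"
  proof (cases k)
    case (Suc m)
    then have "\<not> (1/2::real) ^ Suc m < h"
      using not_less_Least[of m "\<lambda>k. (1/2::real) ^ Suc k < h"] by (simp add: k_def)
    with Suc show ?thesis by simp
  qed (use assms in simp)
  with a that show ?thesis by blast
qed

text \<open>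
  The quantitative output of the scheme, from which the regularity of the limit follows without
  further reference to subdivision.
\<close>

locale dyadic_approximation =
  fixes z :: "nat \<Rightarrow> int \<Rightarrow> real" and Z :: "real \<Rightarrow> real" and M A B K c :: real
  assumes init: "\<bar>z 0 i\<bar> \<le> M"
    and first: "\<bar>z k (i + 1) - z k i\<bar> \<le> (A + B * real k) * (1/2) ^ k"
    and second: "\<bar>second_diff (z k) i\<bar> \<le> K * (1/2) ^ k"
    and approx: "\<bar>pl_interp k (z k) t - Z t\<bar> \<le> c * (1/2) ^ k"
    and B_nonneg: "0 \<le> B"
begin

lemma A_nonneg: "0 \<le> A" using first[of 0 0] by simp
lemma K_nonneg: "0 \<le> K" using second[of 0 0] by simp
lemma c_nonneg: "0 \<le> c" using approx[of 0 0] by simp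
lemma M_nonneg: "0 \<le> M" using init[of 0] by linarith

lemma limit_bounded: "\<bar>Z t\<bar> \<le> M + A + c"
proof -
  define i where "i = \<lfloor>t\<rfloor>"
  define s where "s = t - of_int i"
  have s: "0 \<le> s" "s < 1" unfolding s_def i_def by linarith+
  have "pl_interp 0 (z 0) t = z 0 i + s * (z 0 (i + 1) - z 0 i)"
    by (simp add: pl_interp_def Let_def i_def s_def algebra_simps)
  moreover have "\<bar>s * (z 0 (i + 1) - z 0 i)\<bar> \<le> 1 * A"
    unfolding abs_mult using s first[of 0 i] by (intro mult_mono) auto
  ultimately show ?thesis using init[of i] approx[of 0 t] by simp
qed

lemma limit_modulus_dyadic:
  assumes "\<bar>s - t\<bar> \<le> (1/2) ^ k"
  shows "\<bar>Z s - Z t\<bar> \<le> (3 * A + 2 * c + 3 * B * real k) * (1/2) ^ k"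
proof -
  have "2 ^ k * \<bar>s - t\<bar> \<le> 1" using assms by (simp add: field_simps)
  from pl_interp_near[where u = "z k", OF first this] approx[of k s] approx[of k t]
  have "\<bar>Z s - Z t\<bar> \<le> 3 * ((A + B * real k) * (1/2) ^ k) + 2 * (c * (1/2) ^ k)" by linarith
  then show ?thesis by (simp add: algebra_simps)
qed

text \<open>
  Continuity comes from the modulus of the limit itself, because \<open>k 2\<^sup>-\<^sup>k\<close> tends to zero.
\<close>

lemma limit_continuous: "continuous_on UNIV Z"
  unfolding continuous_on_iff
proof (intro ballI allI impI)
  fix t e :: real assume "0 < e"
  have "(\<lambda>k. (3 * A + 2 * c) * (1/2) ^ k + 3 * B * (real k * (1/2) ^ k))
      \<longlonglongrightarrow> (3 * A + 2 * c) * 0 + 3 * B * 0"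
    by (intro tendsto_intros LIMSEQ_power_zero powser_times_n_limit_0) auto
  then have "\<forall>\<^sub>F k in sequentially. (3 * A + 2 * c) * (1/2) ^ k + 3 * B * (real k * (1/2) ^ k) < e"
    using \<open>0 < e\<close> by (auto dest: order_tendstoD)
  then obtain k where k: "(3 * A + 2 * c) * (1/2) ^ k + 3 * B * (real k * (1/2) ^ k) < e"
    using eventually_happens'[OF sequentially_bot] by blast
  have "dist (Z s) (Z t) < e" if "dist s t < (1/2) ^ k" for s
    using limit_modulus_dyadic[of s t k] k that by (simp add: dist_real_def algebra_simps)
  then show "\<exists>d>0. \<forall>s\<in>UNIV. dist s t < d \<longrightarrow> dist (Z s) (Z t) < e"
    by (intro exI[of _ "(1/2) ^ k"]) simp
qed

lemma limit_uniform: "uniform_limit UNIV (\<lambda>k. pl_interp k (z k)) Z sequentially"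
proof (rule uniform_limitI)
  fix e :: real assume "0 < e"
  have "(\<lambda>k. c * (1/2) ^ k) \<longlonglongrightarrow> c * 0"
    by (intro tendsto_intros LIMSEQ_power_zero) auto
  then have "\<forall>\<^sub>F k in sequentially. c * (1/2) ^ k < e"
    using \<open>0 < e\<close> by (auto dest: order_tendstoD)
  then show "\<forall>\<^sub>F k in sequentially. \<forall>t\<in>UNIV. dist (pl_interp k (z k) t) (Z t) < e"
    by eventually_elim (use approx in \<open>auto simp: dist_real_def intro: le_less_trans\<close>)
qed

text \<open>
  If \<open>h\<close> is comparable to \<open>2\<^sup>-\<^sup>k\<close>, then \<open>k \<le> ln (1/h) / ln 2\<close>.  For \<open>h \<le> 1/e\<close> the
  logarithm is at least one and also absorbs the constant terms.
\<close>

lemma limit_log_modulus: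
  assumes h: "0 < h" "h \<le> exp (- 1)" and st: "\<bar>s - t\<bar> \<le> h"
  shows "\<bar>Z s - Z t\<bar> \<le> 2 * (3 * A + 2 * c + 3 * B / ln 2) * (h * ln (1 / h))"
proof -
  have "h \<le> 1" using h(2) by (rule order_trans) simp
  then obtain k where k: "(1/2) ^ Suc k < h" "h \<le> (1/2) ^ k" using dyadic_scale h(1) by blast
  have "ln h \<le> ln (exp (- 1))" using h by (subst ln_le_cancel_iff) auto
  then have one: "1 \<le> ln (1 / h)" using h by (simp add: ln_div)
  have "ln h \<le> ln ((1/2) ^ k)" using h k by (subst ln_le_cancel_iff) auto
  then have "real k * ln 2 \<le> ln (1 / h)" using h by (simp add: ln_div ln_realpow)
  then have kl: "real k \<le> ln (1 / h) / ln 2" by (simp add: field_simps)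
  have "\<bar>Z s - Z t\<bar> \<le> (3 * A + 2 * c + 3 * B * real k) * (1/2) ^ k"
    using st k by (intro limit_modulus_dyadic) linarith
  also have "\<dots> \<le> ((3 * A + 2 * c) * ln (1 / h) + 3 * B * (ln (1 / h) / ln 2)) * (2 * h)"
  proof (rule mult_mono)
    have "3 * A + 2 * c \<le> (3 * A + 2 * c) * ln (1 / h)"
      using mult_left_mono[OF one, of "3 * A + 2 * c"] A_nonneg c_nonneg by simp
    moreover have "3 * B * real k \<le> 3 * B * (ln (1 / h) / ln 2)"
      using kl B_nonneg by (intro mult_left_mono) auto
    ultimately show "3 * A + 2 * c + 3 * B * real k
        \<le> (3 * A + 2 * c) * ln (1 / h) + 3 * B * (ln (1 / h) / ln 2)" by (rule add_mono)
    show "0 \<le> (3 * A + 2 * c) * ln (1 / h) + 3 * B * (ln (1 / h) / ln 2)"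
      using one A_nonneg B_nonneg c_nonneg by (intro add_nonneg_nonneg mult_nonneg_nonneg) auto
  qed (use k in auto)
  finally show ?thesis by (simp add: algebra_simps)
qed

text \<open>
  Small steps are compared with the dyadic level of their own size.  For steps larger than one the
  boundedness of the limit suffices.
\<close>

lemma limit_zygmund:
  "\<bar>Z (x + h) - 2 * Z x + Z (x - h)\<bar> \<le> (4 * K + 8 * c + 4 * (M + A + c)) * \<bar>h\<bar>"
proof -
  consider "h = 0" | "0 < \<bar>h\<bar>" "\<bar>h\<bar> \<le> 1" | "1 < \<bar>h\<bar>" by linarith
  then show ?thesis
  proof cases
    case 2
    then obtain k where k: "(1/2) ^ Suc k < \<bar>h\<bar>" "\<bar>h\<bar> \<le> (1/2) ^ k" using dyadic_scale by blast
    have "2 ^ k * \<bar>h\<bar> \<le> 1" using k(2) by (simp add: field_simps)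
    from pl_interp_second_diff[where u = "z k", OF second this, of x]
      approx[of k "x + h"] approx[of k x] approx[of k "x - h"]
    have "\<bar>Z (x + h) - 2 * Z x + Z (x - h)\<bar> \<le> 2 * (K * (1/2) ^ k) + 4 * (c * (1/2) ^ k)"
      by linarith
    also have "\<dots> = (2 * K + 4 * c) * (1/2) ^ k" by (simp add: algebra_simps)
    also have "\<dots> \<le> (2 * K + 4 * c) * (2 * \<bar>h\<bar>)"
      using k(1) K_nonneg c_nonneg by (intro mult_left_mono) auto
    also have "\<dots> = (4 * K + 8 * c) * \<bar>h\<bar>" by (simp add: algebra_simps)
    also have "\<dots> \<le> (4 * K + 8 * c + 4 * (M + A + c)) * \<bar>h\<bar>"
      using M_nonneg A_nonneg c_nonneg by (intro mult_right_mono) auto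
    finally show ?thesis .
  next
    case 3
    have "\<bar>Z (x + h) - 2 * Z x + Z (x - h)\<bar> \<le> 4 * (M + A + c)"
      using limit_bounded[of "x + h"] limit_bounded[of x] limit_bounded[of "x - h"]
      unfolding distrib_left by linarith
    also have "\<dots> = 4 * (M + A + c) * 1" by simp
    also have "\<dots> \<le> (4 * K + 8 * c + 4 * (M + A + c)) * \<bar>h\<bar>"
      using 3 M_nonneg A_nonneg c_nonneg K_nonneg by (intro mult_mono) auto
    finally show ?thesis .
  qed simp
qed

end

section \<open>The Heisenberg scheme\<close>

lemma L4_odd:
  "L4 (1/16) u (2 * i + 1) =
    (u i + u (i + 1)) / 2 - (second_diff u i + second_diff u (i + 1)) / 16"
  by (simp add: L4_def second_diff_def Let_def field_simps)

text \<open>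
  The horizontal coordinates: the unforced scheme keeps bounded data bounded, with Lipschitz
  constants that are uniform in the level.
\<close>

lemma four_point_bounds:
  assumes "perturbed_four_point u (\<lambda>_ _. 0)" and C: "\<And>i. \<bar>u 0 i\<bar> \<le> C"
  obtains M D where "\<And>k i. \<bar>u k i\<bar> \<le> M" "\<And>k i. \<bar>u k (i + 1) - u k i\<bar> \<le> D * (1/2) ^ k"
proof -
  interpret perturbed_four_point u "\<lambda>_ _. 0" by fact
  have B: "\<bar>second_diff (u 0) i\<bar> \<le> 4 * C" for i
    using C[of "i + 1"] C[of i] C[of "i - 1"] unfolding second_diff_def by linarith
  obtain K where K: "\<And>k i. \<bar>second_diff (u k) i\<bar> \<le> K * (9/20) ^ k"
    using second_diff_decay[of "4 * C" 0 "9/20", OF B] by auto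
  have m: "\<bar>u (Suc k) (2 * i + 1) - (u k i + u k (i + 1)) / 2\<bar> \<le> (K / 8 + 0) * (9/20) ^ k" for k i
    by (rule midpoint_deviation[OF K]) simp
  have "\<bar>u 0 (i + 1) - u 0 i\<bar> \<le> 2 * C" for i
    using C[of "i + 1"] C[of i] by linarith
  from first_diff_decay_fast[OF this m] values_bounded[OF C m] that show thesis by blast
qed

lemma heis_subdiv_even: "heis_subdiv w P (2 * i) = P i"
  by (simp add: heis_subdiv_def Let_def)

text \<open>
  The area term pairs a bounded horizontal coordinate with the increment of the other one to the
  inserted point.  This increment is a first difference of the next level, so the area term
  is at most of the critical size \<open>2\<^sup>-\<^sup>k\<close>, which the decay estimate tolerates.
\<close>

lemma heisenberg_dyadic_approximation:
  fixes P :: "nat \<Rightarrow> int \<Rightarrow> point"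
  assumes C: "\<And>i. norm (P 0 i) \<le> C" and P: "\<And>k. P (Suc k) = heis_subdiv (1/16) (P k)"
  shows "\<exists>Z M A B K c. dyadic_approximation (\<lambda>k i. zco (P k i)) Z M A B K c"
proof -
  define x where "x k i = xco (P k i)" for k i
  define y where "y k i = yco (P k i)" for k i
  define z where "z k i = zco (P k i)" for k i
  define R where "R k i = 1/2 * (x k i * (y (Suc k) (2 * i + 1) - y k i)
      - y k i * (x (Suc k) (2 * i + 1) - x k i))" for k i
  have even: "P (Suc k) (2 * i) = P k i" for k i by (simp add: P heis_subdiv_even)
  have xo: "x (Suc k) (2 * i + 1) = L4 (1/16) (x k) (2 * i + 1)"
    and yo: "y (Suc k) (2 * i + 1) = L4 (1/16) (y k) (2 * i + 1)" for k i
    by (simp_all add: x_def[abs_def] y_def[abs_def] P heis_subdiv_def Let_def xco_def yco_def)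
  have zo: "z (Suc k) (2 * i + 1) = L4 (1/16) (z k) (2 * i + 1) + R k i" for k i
    unfolding R_def xo yo
    by (simp add: x_def[abs_def] y_def[abs_def] z_def[abs_def] P heis_subdiv_def Let_def zco_def)
  have X: "perturbed_four_point x (\<lambda>_ _. 0)" and Y: "perturbed_four_point y (\<lambda>_ _. 0)"
    by unfold_locales (unfold xo yo L4_odd, simp_all add: x_def y_def even)
  have Z: "perturbed_four_point z R"
    by unfold_locales (unfold zo L4_odd, simp_all add: z_def even)
  have init: "\<bar>x 0 i\<bar> \<le> C" "\<bar>y 0 i\<bar> \<le> C" "\<bar>z 0 i\<bar> \<le> C" for i
    using norm_fst_le[of "fst (P 0 i)" "snd (P 0 i)"] norm_snd_le[of "snd (P 0 i)" "fst (P 0 i)"]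
      norm_fst_le[of "fst (snd (P 0 i))" "snd (snd (P 0 i))"]
      norm_snd_le[of "snd (snd (P 0 i))" "fst (snd (P 0 i))"] C[of i]
    by (auto simp: x_def y_def z_def xco_def yco_def zco_def)
  obtain M D where x: "\<And>k i. \<bar>x k i\<bar> \<le> M" "\<And>k i. \<bar>x k (i + 1) - x k i\<bar> \<le> D * (1/2) ^ k"
    using four_point_bounds[OF X init(1)] by blast
  obtain M' D' where y: "\<And>k i. \<bar>y k i\<bar> \<le> M'" "\<And>k i. \<bar>y k (i + 1) - y k i\<bar> \<le> D' * (1/2) ^ k"
    using four_point_bounds[OF Y init(2)] by blast
  have M0: "0 \<le> M" "0 \<le> M'" using x(1)[of 0 0] y(1)[of 0 0] by linarith+
  \<comment> \<open>A factor \<open>1/2\<close> comes from the area and another one from taking the increment at level \<open>Suc k\<close>.\<close>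
  define \<rho> where "\<rho> = (M * D' + M' * D) / 4"
  have R: "\<bar>R k i\<bar> \<le> \<rho> * (1/2) ^ k" for k i
  proof -
    have a: "\<bar>x (Suc k) (2 * i + 1) - x k i\<bar> \<le> D / 2 * (1/2) ^ k"
      using x(2)[of "Suc k" "2 * i"] by (simp add: x_def even)
    have b: "\<bar>y (Suc k) (2 * i + 1) - y k i\<bar> \<le> D' / 2 * (1/2) ^ k"
      using y(2)[of "Suc k" "2 * i"] by (simp add: y_def even)
    have half: "\<bar>1/2 * (s - t)\<bar> \<le> (S + T) / 2" if "\<bar>s\<bar> \<le> S" "\<bar>t\<bar> \<le> T" for s t S T :: real
      using that by (simp add: abs_le_iff)
    have p: "\<bar>x k i * (y (Suc k) (2 * i + 1) - y k i)\<bar> \<le> M * (D' / 2 * (1/2) ^ k)"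
      unfolding abs_mult using x(1) b M0 by (intro mult_mono) auto
    have q: "\<bar>y k i * (x (Suc k) (2 * i + 1) - x k i)\<bar> \<le> M' * (D / 2 * (1/2) ^ k)"
      unfolding abs_mult using y(1) a M0 by (intro mult_mono) auto
    have "\<bar>R k i\<bar> \<le> (M * (D' / 2 * (1/2) ^ k) + M' * (D / 2 * (1/2) ^ k)) / 2"
      unfolding R_def by (rule half[OF p q])
    then show ?thesis by (simp add: \<rho>_def field_simps)
  qed
  interpret perturbed_four_point z R by (fact Z)
  have B: "\<bar>second_diff (z 0) i\<bar> \<le> 4 * C" for i
    using init(3)[of "i + 1"] init(3)[of i] init(3)[of "i - 1"] unfolding second_diff_def by linarith
  obtain K where K: "\<And>k i. \<bar>second_diff (z k) i\<bar> \<le> K * (1/2) ^ k"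
    using second_diff_decay[OF B R] by auto
  define m where "m = K / 8 + \<rho>"
  have m: "\<bar>z (Suc k) (2 * i + 1) - (z k i + z k (i + 1)) / 2\<bar> \<le> m * (1/2) ^ k" for k i
    unfolding m_def by (rule midpoint_deviation[OF K R])
  have "\<bar>z 0 (i + 1) - z 0 i\<bar> \<le> 2 * C" for i
    using init(3)[of "i + 1"] init(3)[of i] by linarith
  note first = first_diff_decay_critical[OF this m]
  have "\<exists>l. \<forall>k. \<bar>pl_interp k (z k) t - l\<bar> \<le> 2 * m * (1/2) ^ k" for t
    using geometric_increments_limit[of "\<lambda>k. pl_interp k (z k) t" m]
      pl_interp_refine[OF even_rule m] by metis
  then obtain Z where "\<And>t k. \<bar>pl_interp k (z k) t - Z t\<bar> \<le> 2 * m * (1/2) ^ k" by metis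
  moreover have "0 \<le> m" using m[of 0 0] by simp
  ultimately have "dyadic_approximation z Z C (2 * C) (2 * m) K (2 * m)"
    using init(3) first K by unfold_locales auto
  then show ?thesis unfolding z_def by blast
qed

lemma central_limit_iff:
  assumes "dyadic_approximation (\<lambda>k i. zco (P k i)) Z M A B K c"
  shows "is_central_limit P Z' \<longleftrightarrow> Z' = Z"
proof
  interpret dyadic_approximation "\<lambda>k i. zco (P k i)" Z M A B K c by fact
  assume "is_central_limit P Z'"
  then have "uniform_limit {t..t} (\<lambda>k. pl_interp k (\<lambda>i. zco (P k i))) Z' sequentially" for t
    unfolding is_central_limit_def by blast
  then have "(\<lambda>k. pl_interp k (\<lambda>i. zco (P k i)) t) \<longlonglongrightarrow> Z' t" for t
    by (rule tendsto_uniform_limitI) simp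
  moreover have "(\<lambda>k. pl_interp k (\<lambda>i. zco (P k i)) t) \<longlonglongrightarrow> Z t" for t
    using limit_uniform by (rule tendsto_uniform_limitI) simp
  ultimately show "Z' = Z" using LIMSEQ_unique by blast
next
  interpret dyadic_approximation "\<lambda>k i. zco (P k i)" Z M A B K c by fact
  assume "Z' = Z"
  then show "is_central_limit P Z'"
    unfolding is_central_limit_def
    using limit_continuous uniform_limit_on_subset[OF limit_uniform] by blast
qed

lemma abs_real_of_ereal_le:
  assumes "0 \<le> x" "x \<le> ereal b"
  shows "\<bar>real_of_ereal x\<bar> \<le> b"
  using assms by (cases x) auto

theorem theorem5p10:
  shows "\<exists>\<epsilon>0>0. \<forall>(C::real) (P :: nat \<Rightarrow> int \<Rightarrow> point).
    small_data C \<epsilon>0 (P 0) \<longrightarrow> (\<forall>k. P (Suc k) = heis_subdiv (1/16) (P k)) \<longrightarrow>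
      (\<exists>K0. \<forall>k. (SUP i. ereal \<bar>zco (P k (i + 2)) - 2 * zco (P k (i + 1)) + zco (P k i)\<bar>)
                 \<le> ereal (K0 * 2 powr (- real k))) \<and>
      (\<exists>!Z. is_central_limit P Z) \<and>
      (\<forall>Z. is_central_limit P Z \<longrightarrow>
         Z \<in> zygmund_class \<and>
         (\<exists>K. \<forall>h. second_diff_sup Z h \<le> ereal (K * \<bar>h\<bar>)) \<and>
         (\<forall>h>0. modulus_of_continuity Z h < \<infinity>) \<and>
         (\<lambda>h. real_of_ereal (modulus_of_continuity Z h)) \<in> O[at_right 0](\<lambda>h. h * ln (1 / h))) \<and>
      (\<forall>k. (SUP i. ereal (2 ^ k * \<bar>zco (P k (i + 1)) - zco (P k i)\<bar>)) < \<infinity>) \<and>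
      (\<lambda>k. real_of_ereal (SUP i. ereal (2 ^ k * \<bar>zco (P k (i + 1)) - zco (P k i)\<bar>)))
        \<in> O(\<lambda>k. real k)"
proof (rule exI[of _ 1], intro conjI allI impI)
  show "(0::real) < 1" by simp
  fix C :: real and P :: "nat \<Rightarrow> int \<Rightarrow> point"
  assume small: "small_data C 1 (P 0)" and step: "\<forall>k. P (Suc k) = heis_subdiv (1/16) (P k)"
  have "norm (P 0 i) \<le> C" for i
    using small by (simp add: small_data_def SUP_le_iff)
  from heisenberg_dyadic_approximation[of P, OF this] step
  obtain Z M A B K c where dy: "dyadic_approximation (\<lambda>k i. zco (P k i)) Z M A B K c"
    by blast
  interpret dyadic_approximation "\<lambda>k i. zco (P k i)" Z M A B K c by (fact dy)
  note lim = central_limit_iff[OF dy]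

  have "\<bar>zco (P k (i + 2)) - 2 * zco (P k (i + 1)) + zco (P k i)\<bar> \<le> K * 2 powr (- real k)" for k i
    using second[of k "i + 1"]
    by (simp add: second_diff_def powr_minus powr_realpow power_one_over inverse_eq_divide add.commute)
  then have "(SUP i. ereal \<bar>zco (P k (i + 2)) - 2 * zco (P k (i + 1)) + zco (P k i)\<bar>)
      \<le> ereal (K * 2 powr (- real k))" for k
    by (intro SUP_least) simp
  then show "\<exists>K0. \<forall>k. (SUP i. ereal \<bar>zco (P k (i + 2)) - 2 * zco (P k (i + 1)) + zco (P k i)\<bar>)
      \<le> ereal (K0 * 2 powr (- real k))" by blast

  show "\<exists>!Z. is_central_limit P Z" by (simp add: lim)

  have scaled: "(SUP i. ereal (2 ^ k * \<bar>zco (P k (i + 1)) - zco (P k i)\<bar>)) \<le> ereal (A + B * real k)"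
    for k
    using first[of k] by (intro SUP_least) (simp add: field_simps)
  show "(SUP i. ereal (2 ^ k * \<bar>zco (P k (i + 1)) - zco (P k i)\<bar>)) < \<infinity>" for k
    using scaled[of k] by (rule le_less_trans) simp
  show "(\<lambda>k. real_of_ereal (SUP i. ereal (2 ^ k * \<bar>zco (P k (i + 1)) - zco (P k i)\<bar>)))
      \<in> O(\<lambda>k. real k)"
  proof (rule bigoI)
    show "\<forall>\<^sub>F k in sequentially.
        norm (real_of_ereal (SUP i. ereal (2 ^ k * \<bar>zco (P k (i + 1)) - zco (P k i)\<bar>)))
        \<le> (A + B) * norm (real k)"
      using eventually_ge_at_top[of 1]
    proof eventually_elim
      case (elim k)
      have "0 \<le> (SUP i. ereal (2 ^ k * \<bar>zco (P k (i + 1)) - zco (P k i)\<bar>))"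
        by (intro SUP_upper2[of 0]) auto
      from abs_real_of_ereal_le[OF this scaled]
      have "norm (real_of_ereal (SUP i. ereal (2 ^ k * \<bar>zco (P k (i + 1)) - zco (P k i)\<bar>)))
          \<le> A + B * real k" by simp
      also have "\<dots> \<le> (A + B) * norm (real k)"
        using elim mult_left_mono[of 1 "real k" A] A_nonneg by (simp add: algebra_simps)
      finally show ?case .
    qed
  qed

  have zyg: "\<exists>K. \<forall>h. second_diff_sup Z h \<le> ereal (K * \<bar>h\<bar>)"
    unfolding second_diff_sup_def using limit_zygmund
    by (intro exI allI SUP_least) (simp only: ereal_less_eq)
  fix Z' assume "is_central_limit P Z'"
  then have Z': "Z' = Z" by (simp add: lim)
  show "\<exists>K. \<forall>h. second_diff_sup Z' h \<le> ereal (K * \<bar>h\<bar>)" using zyg Z' by simp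
  show "Z' \<in> zygmund_class"
    using zyg limit_continuous by (simp add: zygmund_class_def Z')
  show "modulus_of_continuity Z' h < \<infinity>" for h
  proof -
    have "\<bar>Z s - Z t\<bar> \<le> 2 * (M + A + c)" for s t
      using limit_bounded[of s] limit_bounded[of t] unfolding distrib_left by linarith
    then have "modulus_of_continuity Z h \<le> ereal (2 * (M + A + c))"
      unfolding modulus_of_continuity_def by (intro SUP_least) auto
    then show ?thesis unfolding Z' by (rule le_less_trans) simp
  qed
  show "(\<lambda>h. real_of_ereal (modulus_of_continuity Z' h)) \<in> O[at_right 0](\<lambda>h. h * ln (1 / h))"
  proof (rule bigoI)
    have "\<forall>\<^sub>F h in at_right (0::real). h \<in> {0<..<exp (- 1)}"
      by (rule eventually_at_right_real) simp
    then show "\<forall>\<^sub>F h in at_right 0. norm (real_of_ereal (modulus_of_continuity Z' h))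
        \<le> 2 * (3 * A + 2 * c + 3 * B / ln 2) * norm (h * ln (1 / h))"
    proof eventually_elim
      case (elim h)
      then have h: "0 < h" "h \<le> exp (- 1)" by auto
      have "h \<le> 1" using h(2) by (rule order_trans) simp
      then have pos: "0 \<le> h * ln (1 / h)" using h(1) by simp
      have upper: "modulus_of_continuity Z h
          \<le> ereal (2 * (3 * A + 2 * c + 3 * B / ln 2) * (h * ln (1 / h)))"
        unfolding modulus_of_continuity_def
        using limit_log_modulus[OF h] by (intro SUP_least) auto
      have "0 \<le> modulus_of_continuity Z h"
        unfolding modulus_of_continuity_def using h(1) by (intro SUP_upper2[of "(0, 0)"]) auto
      from abs_real_of_ereal_le[OF this upper] show ?case
        unfolding Z' real_norm_def abs_of_nonneg[OF pos] .
    qed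
  qed
qed

end
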